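(* Let $\mu$ be a singular cardinal. (A) Suppose that: (a) $\omega=\mathrm{cf}(\mu)<\mu<2^{\omega}$ and $(\mu_n:n<\omega)$ is an increasing sequence of regular cardinals with $\mu=\bigcup_{n<\omega}\mu_n$; (b) $J$ is an ideal on $\omega$ containing all bounded subsets of $\omega$ and ${\rm tcf}(\prod_{n<\omega}\mu_n,J)=\mu^+$, as witnessed by the scale $(f_\alpha:\alpha<\mu^+)$; (c) for every $A\subseteq\mu^+$ with $|A|=\aleph_1$, $|\{f_\alpha(n):\alpha\in A,n<\omega\}|=\aleph_1$. Then $\mathfrak{gp}\neq\mu$. (B) Suppose that: (a) $\omega_1=\mathrm{cf}(\mu)<\mu\leq 2^{\omega}$ and $(\mu_\gamma:\gamma<\omega_1)$ is an increasing sequence of regular cardinals with $\mu=\bigcup_{\gamma<\omega_1}\mu_\gamma$; (b) $J$ is an ideal on $\omega_1$ containing all bounded subsets of $\omega_1$ and ${\rm tcf}(\prod_{\gamma<\omega_1}\mu_\gamma,J)=\mu^+$, as witnessed by the scale $(g_\alpha:\alpha<\mu^+)$; (c) for every $A\subseteq\mu^+$ with $|A|=\aleph_1$ there is $\delta<\omega_1$ such that $|\{g_\alpha(\gamma):\alpha\in A,\gamma<\delta\}|=\aleph_1$. Then $\mathfrak{gp}\neq\mu$.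
   Context: $\mathfrak{gp}$ is the minimal cardinal $\kappa$ such that every family $\{C_\alpha:\alpha<\kappa^+\}$ of club subsets of $\omega_1$ contains a subfamily $\{C_{\alpha_\beta}:\beta<\omega_1\}$ (distinct indices) whose intersection is closed and unbounded in $\omega_1$. For an index set $I$, an ideal $J$ on $I$ and functions $f,g$, write $f<_J g$ iff $\{i: f(i)\geq g(i)\}\in J$. The statement ${\rm tcf}(\prod_{i\in I}\mu_i,J)=\lambda$ witnessed by the scale $(f_\alpha:\alpha<\lambda)$ means that each $f_\alpha\in\prod_{i\in I}\mu_i$, the sequence is $<_J$-increasing, and it is cofinal: for every $g\in\prod_i\mu_i$ there is $\alpha$ with $g<_J f_\alpha$. *)

theory Defs
  imports Main "HOL-Library.FuncSet"
begin

unbundle cardinal_syntax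

text \<open>
  Cardinals are the cardinal orders of the library.  An ordinal below a cardinal \<open>\<mu> :: 'm rel\<close> is an
  element \<open>a \<in> Field \<mu>\<close>, and \<open>underS \<mu> a\<close> is its set of predecessors, i.e. the von Neumann ordinal
  itself.  Equality of cardinals is \<open>=o\<close>.
\<close>

abbreviation omega1 :: "nat set rel" where
  "omega1 \<equiv> cardSuc natLeq"

abbreviation continuum :: "(nat \<Rightarrow> bool) rel" where
  "continuum \<equiv> ctwo ^c natLeq"

definition regular_cardinal :: "'a rel \<Rightarrow> bool" where
  "regular_cardinal r \<longleftrightarrow> Cinfinite r \<and> regularCard r"

definition singular_cardinal :: "'a rel \<Rightarrow> bool" where
  "singular_cardinal r \<longleftrightarrow> Cinfinite r \<and> \<not> regularCard r"

text \<open>The library's \<open>cofinal\<close> asks for strict bounds, so \<open>cf\<close> is meant for limit orders only.\<close>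

definition cf :: "'a rel \<Rightarrow> 'a rel" where
  "cf r = |SOME A. A \<subseteq> Field r \<and> cofinal A r \<and>
              (\<forall>B. B \<subseteq> Field r \<and> cofinal B r \<longrightarrow> |A| \<le>o |B| )|"

lemma cf_spec:
  assumes "Cinfinite r"
  shows "\<exists>A. cf r = |A| \<and> A \<subseteq> Field r \<and> cofinal A r \<and>
           (\<forall>B. B \<subseteq> Field r \<and> cofinal B r \<longrightarrow> |A| \<le>o |B| )"
proof -
  let ?P = "\<lambda>A. A \<subseteq> Field r \<and> cofinal A r"
  let ?R = "card_of ` Collect ?P"
  have "cofinal (Field r) r"
    unfolding cofinal_def
    using assms infinite_Card_order_limit unfolding cinfinite_def by fastforce
  hence "?R \<noteq> {}" "\<forall>s \<in> ?R. Card_order s"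
    using card_of_Card_order by auto
  then obtain A where "?P A" "\<forall>B. ?P B \<longrightarrow> |A| \<le>o |B|"
    using exists_minim_Card_order[of ?R] by blast
  hence "\<exists>A. A \<subseteq> Field r \<and> cofinal A r \<and> (\<forall>B. B \<subseteq> Field r \<and> cofinal B r \<longrightarrow> |A| \<le>o |B| )"
    by blast
  from someI_ex[OF this] show ?thesis
    unfolding cf_def by blast
qed


subsection \<open>Club sets and the cardinal gp\<close>

text \<open>The bound \<open>c\<close> is strictly above \<open>a\<close>, so a \<open>\<delta>\<close> as below is a limit ordinal and
  \<open>C \<inter> \<delta>\<close> is unbounded in it.\<close>

definition closed_in_order :: "'a rel \<Rightarrow> 'a set \<Rightarrow> bool" where
  "closed_in_order r C \<longleftrightarrow>
     (\<forall>\<delta> \<in> Field r. underS r \<delta> \<noteq> {} \<and>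
        (\<forall>a \<in> underS r \<delta>. \<exists>c \<in> C \<inter> underS r \<delta>. a \<noteq> c \<and> (a, c) \<in> r) \<longrightarrow> \<delta> \<in> C)"

definition club :: "'a rel \<Rightarrow> 'a set \<Rightarrow> bool" where
  "club r C \<longleftrightarrow> C \<subseteq> Field r \<and> cofinal C r \<and> closed_in_order r C"

definition gp_property :: "'k rel \<Rightarrow> bool" where
  "gp_property \<kappa> \<longleftrightarrow>
     (\<forall>C :: 'k set \<Rightarrow> nat set set. (\<forall>\<alpha> \<in> Field (cardSuc \<kappa>). club omega1 (C \<alpha>)) \<longrightarrow>
        (\<exists>h. inj_on h (Field omega1) \<and> h ` Field omega1 \<subseteq> Field (cardSuc \<kappa>) \<and>
             club omega1 (\<Inter>\<beta> \<in> Field omega1. C (h \<beta>))))"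

text \<open>
  Clubs are elements of the carrier type \<open>nat set set\<close>, so a family indexed by the successor of the
  cardinality of this type repeats some club \<open>\<aleph>\<^sub>1\<close> times.  Hence \<open>gp\<close> exists on this type, and it is
  minimal among the cardinals on all types; see \<open>gp_property_gp\<close> and \<open>gp_least\<close>.
\<close>

definition gp :: "nat set set rel" where
  "gp = (SOME \<kappa>. Card_order \<kappa> \<and> gp_property \<kappa> \<and>
           (\<forall>\<kappa>' :: nat set set rel. Card_order \<kappa>' \<and> gp_property \<kappa>' \<longrightarrow> \<kappa> \<le>o \<kappa>'))"

lemma gp_property_mono:
  assumes "Card_order \<kappa>" "Card_order \<kappa>'" "\<kappa> \<le>o \<kappa>'" "gp_property \<kappa>"
  shows "gp_property \<kappa>'"
  unfolding gp_property_def
proof (intro allI impI)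
  fix C assume C: "\<forall>\<alpha> \<in> Field (cardSuc \<kappa>'). club omega1 (C \<alpha>)"
  have "cardSuc \<kappa> \<le>o cardSuc \<kappa>'"
    using assms by (simp add: cardSuc_mono_ordLeq)
  hence "|Field (cardSuc \<kappa>)| \<le>o |Field (cardSuc \<kappa>')|"
    by (rule card_of_mono2)
  then obtain e where e: "inj_on e (Field (cardSuc \<kappa>))"
      "e ` Field (cardSuc \<kappa>) \<subseteq> Field (cardSuc \<kappa>')"
    using card_of_ordLeq by metis
  have "\<forall>\<alpha> \<in> Field (cardSuc \<kappa>). club omega1 ((C \<circ> e) \<alpha>)"
    using C e(2) by auto
  then obtain h where h: "inj_on h (Field omega1)" "h ` Field omega1 \<subseteq> Field (cardSuc \<kappa>)"
      "club omega1 (\<Inter>\<beta> \<in> Field omega1. (C \<circ> e) (h \<beta>))"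
    using assms(4) unfolding gp_property_def by blast
  have "inj_on (e \<circ> h) (Field omega1)"
    using h e by (meson comp_inj_on inj_on_subset)
  moreover have "(e \<circ> h) ` Field omega1 \<subseteq> Field (cardSuc \<kappa>')"
    using h(2) e(2) by auto
  ultimately show "\<exists>h. inj_on h (Field omega1) \<and> h ` Field omega1 \<subseteq> Field (cardSuc \<kappa>') \<and>
             club omega1 (\<Inter>\<beta> \<in> Field omega1. C (h \<beta>))"
    using h(3) by (intro exI[of _ "e \<circ> h"]) auto
qed

lemma gp_property_UNIV: "gp_property |UNIV :: nat set set set|"
  unfolding gp_property_def
proof (intro allI impI)
  let ?\<kappa> = "|UNIV :: nat set set set|"
  let ?F = "Field (cardSuc ?\<kappa>)"
  fix C :: "nat set set set \<Rightarrow> nat set set"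
  assume C: "\<forall>\<alpha> \<in> ?F. club omega1 (C \<alpha>)"
  let ?fib = "\<lambda>c. {\<alpha> \<in> ?F. C \<alpha> = c}"
  have inf: "infinite (UNIV :: nat set set set)"
    by (simp add: Finite_Set.finite_set)
  have nat: "natLeq \<le>o ?\<kappa>"
    using inf infinite_iff_natLeq_ordLeq by blast
  have "\<exists>c. \<not> |?fib c| \<le>o natLeq"
  proof (rule ccontr)
    assume "\<not> ?thesis"
    hence "\<forall>c \<in> UNIV. |?fib c| \<le>o ?\<kappa>"
      using nat ordLeq_transitive by blast
    hence "|\<Union>c. ?fib c| \<le>o ?\<kappa>"
      by (rule card_of_UNION_ordLeq_infinite[OF inf card_of_mono1[OF subset_refl]])
    moreover have "(\<Union>c. ?fib c) = ?F"
      by auto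
    moreover have "?\<kappa> <o |?F|"
      using cardSuc_greater[of ?\<kappa>] card_of_Field_ordIso[OF cardSuc_Card_order[of ?\<kappa>]]
      by (meson card_of_Card_order ordIso_symmetric ordLess_ordIso_trans)
    ultimately show False
      by (simp add: not_ordLess_ordLeq)
  qed
  then obtain c where c: "\<not> |?fib c| \<le>o natLeq" by blast
  hence "natLeq <o |?fib c|"
    using not_ordLeq_iff_ordLess[OF natLeq_Well_order card_of_Well_order] by blast
  hence "omega1 \<le>o |?fib c|"
    by (simp add: cardSuc_least natLeq_Card_order card_of_Card_order)
  hence "|Field omega1| \<le>o |?fib c|"
    using card_of_Field_ordIso[OF cardSuc_Card_order[OF natLeq_Card_order]] ordIso_ordLeq_trans
    by blast
  then obtain h where h: "inj_on h (Field omega1)" "h ` Field omega1 \<subseteq> ?fib c"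
    using card_of_ordLeq[of "Field omega1" "?fib c"] by blast
  have ne: "Field omega1 \<noteq> {}"
    using Field_cardSuc_not_empty natLeq_Card_order by blast
  hence "(\<Inter>\<beta> \<in> Field omega1. C (h \<beta>)) = c"
    using h(2) by auto
  moreover have "club omega1 c"
    using C h(2) ne by auto
  ultimately show "\<exists>h. inj_on h (Field omega1) \<and> h ` Field omega1 \<subseteq> ?F \<and>
             club omega1 (\<Inter>\<beta> \<in> Field omega1. C (h \<beta>))"
    using h by (intro exI[of _ h]) auto
qed

lemma gp_spec:
  "Card_order gp \<and> gp_property gp \<and>
     (\<forall>\<kappa>' :: nat set set rel. Card_order \<kappa>' \<and> gp_property \<kappa>' \<longrightarrow> gp \<le>o \<kappa>')"
proof -
  let ?R = "{\<kappa> :: nat set set rel. Card_order \<kappa> \<and> gp_property \<kappa>}"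
  have "?R \<noteq> {}" "\<forall>r \<in> ?R. Card_order r"
    using gp_property_UNIV card_of_Card_order by auto
  then obtain \<kappa> where "\<kappa> \<in> ?R" "\<forall>\<kappa>' \<in> ?R. \<kappa> \<le>o \<kappa>'"
    using exists_minim_Card_order[of ?R] by blast
  hence "\<exists>\<kappa> :: nat set set rel. Card_order \<kappa> \<and> gp_property \<kappa> \<and>
           (\<forall>\<kappa>' :: nat set set rel. Card_order \<kappa>' \<and> gp_property \<kappa>' \<longrightarrow> \<kappa> \<le>o \<kappa>')"
    by blast
  thus ?thesis
    unfolding gp_def by (rule someI_ex)
qed

lemma Card_order_gp: "Card_order gp"
  and gp_property_gp: "gp_property gp"
  using gp_spec by blast+

lemma gp_least:
  fixes \<kappa> :: "'k rel"
  assumes "Card_order \<kappa>" "gp_property \<kappa>"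
  shows "gp \<le>o \<kappa>"
proof (rule ccontr)
  assume "\<not> gp \<le>o \<kappa>"
  hence less: "\<kappa> <o gp"
    using not_ordLeq_iff_ordLess[OF card_order_on_well_order_on[OF assms(1)]
        card_order_on_well_order_on[OF Card_order_gp]] by blast
  hence "|Field \<kappa>| \<le>o |Field gp|"
    by (simp add: card_of_mono2 ordLess_imp_ordLeq)
  then obtain e :: "'k \<Rightarrow> nat set set" where "inj_on e (Field \<kappa>)"
    using card_of_ordLeq by metis
  hence "|Field \<kappa>| =o |e ` Field \<kappa>|"
    using card_of_ordIso[of "Field \<kappa>" "e ` Field \<kappa>"] inj_on_imp_bij_betw by blast
  hence iso: "\<kappa> =o |e ` Field \<kappa>|"
    by (rule ordIso_transitive[OF ordIso_symmetric[OF card_of_Field_ordIso[OF assms(1)]]])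
  hence "gp_property |e ` Field \<kappa>|"
    by (intro gp_property_mono[OF assms(1) card_of_Card_order _ assms(2)] ordIso_imp_ordLeq)
  hence "gp \<le>o |e ` Field \<kappa>|"
    using gp_spec card_of_Card_order by blast
  hence "gp \<le>o \<kappa>"
    by (rule ordLeq_ordIso_trans[OF _ ordIso_symmetric[OF iso]])
  thus False
    using less not_ordLess_ordLeq[of \<kappa> gp] by blast
qed


subsection \<open>Ideals and scales\<close>

text \<open>An ideal is not required to be proper.\<close>

definition ideal_on :: "'i set \<Rightarrow> 'i set set \<Rightarrow> bool" where
  "ideal_on I J \<longleftrightarrow> J \<subseteq> Pow I \<and> {} \<in> J \<and>
     (\<forall>A B. A \<in> J \<and> B \<subseteq> A \<longrightarrow> B \<in> J) \<and> (\<forall>A B. A \<in> J \<and> B \<in> J \<longrightarrow> A \<union> B \<in> J)"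

definition bounded_subset :: "'i rel \<Rightarrow> 'i set \<Rightarrow> bool" where
  "bounded_subset r B \<longleftrightarrow> (\<exists>a \<in> Field r. B \<subseteq> underS r a)"

definition less_mod :: "'m rel \<Rightarrow> 'i set \<Rightarrow> 'i set set \<Rightarrow> ('i \<Rightarrow> 'm) \<Rightarrow> ('i \<Rightarrow> 'm) \<Rightarrow> bool" where
  "less_mod r I J f g \<longleftrightarrow> {i \<in> I. (g i, f i) \<in> r} \<in> J"

text \<open>\<open>m i\<close> is an ordinal below \<open>\<mu>\<close>, viewed as a cardinal through the initial segment of \<open>\<mu>\<close> that it
  determines; the index set of the sequence is the field of the order \<open>\<kappa>\<close>.\<close>

definition regular_sequence :: "'i rel \<Rightarrow> 'm rel \<Rightarrow> ('i \<Rightarrow> 'm) \<Rightarrow> bool" where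
  "regular_sequence \<kappa> \<mu> m \<longleftrightarrow>
     (\<forall>i \<in> Field \<kappa>. m i \<in> Field \<mu> \<and> regular_cardinal (Restr \<mu> (underS \<mu> (m i)))) \<and>
     (\<forall>i j. (i, j) \<in> \<kappa> \<and> i \<noteq> j \<longrightarrow> (m i, m j) \<in> \<mu> \<and> m i \<noteq> m j) \<and>
     Field \<mu> = (\<Union>i \<in> Field \<kappa>. underS \<mu> (m i))"

text \<open>\<open>tcf (\<Prod>i\<in>I. m i, J) = L\<close>, witnessed by the scale \<open>f\<close>, where the \<open>m i\<close> are ordinals below \<open>\<mu>\<close>.\<close>

definition tcf_scale ::
  "'i set \<Rightarrow> 'i set set \<Rightarrow> 'm rel \<Rightarrow> ('i \<Rightarrow> 'm) \<Rightarrow> 'l rel \<Rightarrow> ('l \<Rightarrow> 'i \<Rightarrow> 'm) \<Rightarrow> bool" where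
  "tcf_scale I J \<mu> m L f \<longleftrightarrow>
     (\<forall>\<alpha> \<in> Field L. f \<alpha> \<in> (\<Pi> i \<in> I. underS \<mu> (m i))) \<and>
     (\<forall>\<alpha> \<beta>. (\<alpha>, \<beta>) \<in> L \<and> \<alpha> \<noteq> \<beta> \<longrightarrow> less_mod \<mu> I J (f \<alpha>) (f \<beta>)) \<and>
     (\<forall>g \<in> (\<Pi> i \<in> I. underS \<mu> (m i)). \<exists>\<alpha> \<in> Field L. less_mod \<mu> I J g (f \<alpha>))"

end

theory Submission
  imports Defs "HOL-Library.Countable_Set_Type"
begin

text \<open>
  Suppose \<open>gp = \<mu>\<close>.  Then each \<open>\<mu>\<^sub>i < gp\<close> carries a family \<open>D\<^sub>i\<close> of clubs, indexed by \<open>\<mu>\<^sub>i\<close>, no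
  \<open>\<aleph>\<^sub>1\<close> of which have a club intersection.  Let \<open>C\<^sub>\<alpha>\<close> be the intersection (A), respectively
  the diagonal intersection (B), of the clubs \<open>D\<^sub>i(f\<^sub>\<alpha>(i))\<close>, and let \<open>A\<close> be a set of \<open>\<aleph>\<^sub>1\<close>
  indices below \<open>\<mu>\<^sup>+\<close> such that the \<open>C\<^sub>\<alpha>\<close> with \<open>\<alpha> \<in> A\<close> have a club intersection.  By (c) some
  coordinate \<open>i\<close> takes \<open>\<aleph>\<^sub>1\<close> values \<open>f\<^sub>\<alpha>(i)\<close> on \<open>A\<close>, so \<open>\<aleph>\<^sub>1\<close> clubs of \<open>D\<^sub>i\<close> have a club
  intersection after all, a contradiction.
\<close>

section \<open>Strict predecessors in a well order\<close>

lemma cofinal_underS: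
  "cofinal C r \<longleftrightarrow> (\<forall>a \<in> Field r. \<exists>c \<in> C. a \<in> underS r c)"
  unfolding cofinal_def underS_def by auto

lemma closed_in_order_underS:
  "closed_in_order r C \<longleftrightarrow>
     (\<forall>\<delta> \<in> Field r. underS r \<delta> \<noteq> {} \<and>
        (\<forall>a \<in> underS r \<delta>. \<exists>c \<in> C \<inter> underS r \<delta>. a \<in> underS r c) \<longrightarrow> \<delta> \<in> C)"
  unfolding closed_in_order_def underS_def by auto

lemma underS_trans:
  assumes "Well_order r" "a \<in> underS r b" "b \<in> underS r c"
  shows "a \<in> underS r c"
  using assms unfolding underS_def order_on_defs trans_def antisym_def by blast

lemma underS_total:
  assumes "Well_order r" "a \<in> Field r" "b \<in> Field r"
  shows "a \<in> underS r b \<or> a = b \<or> b \<in> underS r a"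
  using assms unfolding underS_def order_on_defs total_on_def by blast

lemma underS_Fields:
  assumes "a \<in> underS r b"
  shows "a \<in> Field r" "b \<in> Field r"
  using assms unfolding underS_def Field_def by auto

text \<open>The larger of \<open>a\<close> and \<open>b\<close> serves as \<open>c\<close>. This
  merges two lower bounds into one without leaving \<open>X\<close>, which below is a whole field or
  an initial segment.\<close>

lemma underS_max:
  assumes wo: "Well_order r" and X: "a \<in> X" "b \<in> X" "X \<subseteq> Field r"
  obtains c where "c \<in> X" "\<And>d. c \<in> underS r d \<Longrightarrow> a \<in> underS r d \<and> b \<in> underS r d"
proof -
  have "a \<in> underS r b \<or> a = b \<or> b \<in> underS r a"
    using underS_total[OF wo] X by blast
  then show thesis
    using that X underS_trans[OF wo] by metis
qed

lemma underS_Least: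
  assumes wo: "Well_order r" and "P b" "b \<in> Field r"
  obtains c where "c \<in> Field r" "P c" "\<And>d. d \<in> underS r c \<Longrightarrow> \<not> P d"
proof -
  have "wf (r - Id)"
    using wo by (simp add: well_order_on_def)
  then obtain c where "c \<in> {x \<in> Field r. P x}"
      "\<And>d. (d, c) \<in> r - Id \<Longrightarrow> d \<notin> {x \<in> Field r. P x}"
    using assms(2,3) wfE_min[of "r - Id" b "{x \<in> Field r. P x}"] by blast
  then show thesis
    using that[of c] unfolding underS_def Field_def by blast
qed

section \<open>Limits of sequences and diagonal intersections of clubs\<close>

text \<open>\<open>\<delta>\<close> is the least strict upper bound of the sequence; one exists
  because countable sets are bounded.\<close>

lemma increasing_sequence_sup:
  fixes x :: "nat \<Rightarrow> 'a"
  assumes wo: "Well_order r"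
    and bounded: "\<And>S. countable S \<Longrightarrow> S \<subseteq> Field r \<Longrightarrow> \<exists>b \<in> Field r. S \<subseteq> underS r b"
    and x: "\<And>n. x n \<in> underS r (x (Suc n))"
  obtains \<delta> where "\<delta> \<in> Field r" "\<And>n. x n \<in> underS r \<delta>"
    "\<And>b. b \<in> underS r \<delta> \<Longrightarrow> \<exists>n. b \<in> underS r (x n)"
proof -
  have xF: "range x \<subseteq> Field r"
    using x underS_Fields by fast
  then obtain b where "b \<in> Field r" "range x \<subseteq> underS r b"
    using bounded[of "range x"] by auto
  then obtain \<delta> where \<delta>: "\<delta> \<in> Field r" "range x \<subseteq> underS r \<delta>"
      "\<And>d. d \<in> underS r \<delta> \<Longrightarrow> \<not> range x \<subseteq> underS r d"
    using underS_Least[OF wo, of "\<lambda>b. range x \<subseteq> underS r b"] by metis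
  have "\<exists>n. b \<in> underS r (x n)" if b: "b \<in> underS r \<delta>" for b
  proof -
    obtain n where "x n \<notin> underS r b"
      using \<delta>(3)[OF b] by auto
    then have "x n = b \<or> b \<in> underS r (x n)"
      using underS_total[OF wo, of "x n" b] xF underS_Fields(1)[OF b] by auto
    \<comment> \<open>The previous comparison is only weak; moving on to \<open>Suc n\<close> makes
      it strict.\<close>
    then have "b \<in> underS r (x (Suc n))"
      using x[of n] underS_trans[OF wo] by blast
    then show ?thesis by blast
  qed
  then show thesis
    using that \<delta>(1,2) by blast
qed

text \<open>For constant \<open>t\<close> this is essentially the intersection of countably many clubs, and for
  \<open>t = id\<close> the diagonal intersection.\<close>

definition diagonal_inter :: "'a rel \<Rightarrow> 'i set \<Rightarrow> ('i \<Rightarrow> 'a) \<Rightarrow> ('i \<Rightarrow> 'a set) \<Rightarrow> 'a set" where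
  "diagonal_inter r I t D = {\<xi> \<in> Field r. \<forall>i \<in> I. t i \<in> underS r \<xi> \<longrightarrow> \<xi> \<in> D i}"

text \<open>Call \<open>i\<close> active at \<xi> if \<open>t i\<close> lies below \<xi>. Only
  countably many indices are active at any point, so one step can pass above a chosen element of
  every active \<open>D i\<close>; iterating \<omega> times and taking the supremum reaches a limit
  of all the \<open>D i\<close> active there.\<close>

lemma club_diagonal_inter:
  assumes wo: "Well_order r"
    and bounded: "\<And>S. countable S \<Longrightarrow> S \<subseteq> Field r \<Longrightarrow> \<exists>b \<in> Field r. S \<subseteq> underS r b"
    and t: "\<And>\<xi>. \<xi> \<in> Field r \<Longrightarrow> countable {i \<in> I. t i \<in> underS r \<xi>}"
    and D: "\<And>i. i \<in> I \<Longrightarrow> club r (D i)"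
  shows "club r (diagonal_inter r I t D)"
  unfolding club_def
proof (intro conjI)
  show "diagonal_inter r I t D \<subseteq> Field r"
    unfolding diagonal_inter_def by blast
next
  show "closed_in_order r (diagonal_inter r I t D)"
    unfolding closed_in_order_underS
  proof (intro ballI impI, elim conjE)
    fix \<delta> assume \<delta>: "\<delta> \<in> Field r" "underS r \<delta> \<noteq> {}"
      and lim: "\<forall>a \<in> underS r \<delta>. \<exists>c \<in> diagonal_inter r I t D \<inter> underS r \<delta>. a \<in> underS r c"
    have "\<delta> \<in> D i" if i: "i \<in> I" "t i \<in> underS r \<delta>" for i
    proof -
      have "\<exists>c \<in> D i \<inter> underS r \<delta>. a \<in> underS r c" if a: "a \<in> underS r \<delta>" for a
      proof -
        \<comment> \<open>Points of the diagonal intersection above \<open>t i\<close> lie in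
          \<open>D i\<close>, so the bound to exceed is the larger of \<open>a\<close> and
          \<open>t i\<close>.\<close>
        obtain b where b: "b \<in> underS r \<delta>"
            "\<And>d. b \<in> underS r d \<Longrightarrow> a \<in> underS r d \<and> t i \<in> underS r d"
          using underS_max[OF wo a i(2)] Order_Relation.underS_Field by metis
        then show ?thesis
          using lim i unfolding diagonal_inter_def by fast
      qed
      then show ?thesis
        using D[OF i(1)] \<delta> unfolding club_def closed_in_order_underS by blast
    qed
    then show "\<delta> \<in> diagonal_inter r I t D"
      unfolding diagonal_inter_def using \<delta> by blast
  qed
next
  show "cofinal (diagonal_inter r I t D) r"
    unfolding cofinal_underS
  proof
    fix a assume a: "a \<in> Field r"
    have "\<exists>d. \<forall>i\<in>I. \<forall>\<xi>\<in>Field r. d i \<xi> \<in> D i \<and> \<xi> \<in> underS r (d i \<xi>)"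
      using D unfolding club_def cofinal_underS by metis
    then obtain d where d: "\<And>i \<xi>. i \<in> I \<Longrightarrow> \<xi> \<in> Field r \<Longrightarrow> d i \<xi> \<in> D i \<and> \<xi> \<in> underS r (d i \<xi>)"
      by blast
    \<comment> \<open>The next stage must exceed \<xi> itself and the element
      \<open>d i \<xi>\<close> of each \<open>D i\<close> active at \<xi>, a countable set in
      all.\<close>
    have "\<exists>\<eta> \<in> Field r. insert \<xi> ((\<lambda>i. d i \<xi>) ` {i \<in> I. t i \<in> underS r \<xi>}) \<subseteq> underS r \<eta>"
      if "\<xi> \<in> Field r" for \<xi>
      using that t d by (intro bounded) (auto dest: underS_Fields)
    then obtain F where F: "\<And>\<xi>. \<xi> \<in> Field r \<Longrightarrow> F \<xi> \<in> Field r \<and> \<xi> \<in> underS r (F \<xi>)"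
        "\<And>\<xi> i. \<xi> \<in> Field r \<Longrightarrow> i \<in> I \<Longrightarrow> t i \<in> underS r \<xi> \<Longrightarrow> d i \<xi> \<in> underS r (F \<xi>)"
      by (simp add: image_subset_iff) metis
    define x where "x n = (F ^^ n) a" for n
    have xF: "x n \<in> Field r" for n
      by (induction n) (use a F in \<open>auto simp: x_def\<close>)
    have x_Suc: "x (Suc n) = F (x n)" for n
      by (simp add: x_def)
    obtain \<delta> where \<delta>: "\<delta> \<in> Field r" "\<And>n. x n \<in> underS r \<delta>"
        "\<And>b. b \<in> underS r \<delta> \<Longrightarrow> \<exists>n. b \<in> underS r (x n)"
      using increasing_sequence_sup[OF wo bounded, of x] F(1)[OF xF] x_Suc by metis
    have "\<delta> \<in> D i" if i: "i \<in> I" "t i \<in> underS r \<delta>" for i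
    proof -
      have "\<exists>c \<in> D i \<inter> underS r \<delta>. b \<in> underS r c" if b: "b \<in> underS r \<delta>" for b
      proof -
        \<comment> \<open>Once \<open>x n\<close> is above both \<open>b\<close> and
          \<open>t i\<close>, the index \<open>i\<close> is active, so an element of
          \<open>D i\<close> lies strictly between \<open>x n\<close> and
          \<open>x (Suc n)\<close>.\<close>
        obtain c where "c \<in> underS r \<delta>"
            and c: "\<And>d. c \<in> underS r d \<Longrightarrow> b \<in> underS r d \<and> t i \<in> underS r d"
          using underS_max[OF wo b i(2)] Order_Relation.underS_Field by metis
        then obtain n where n: "c \<in> underS r (x n)"
          using \<delta>(3) by blast
        have "d i (x n) \<in> D i" "x n \<in> underS r (d i (x n))" "d i (x n) \<in> underS r (x (Suc n))"
          using d[OF i(1) xF] F(2)[OF xF i(1)] c[OF n] x_Suc by auto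
        then show ?thesis
          using c[OF n] \<delta>(2) underS_trans[OF wo] by blast
      qed
      then show ?thesis
        using D[OF i(1)] \<delta>(1) \<delta>(2)[of 0] unfolding club_def closed_in_order_underS by blast
    qed
    then have "\<delta> \<in> diagonal_inter r I t D"
      unfolding diagonal_inter_def using \<delta>(1) by blast
    then show "\<exists>c \<in> diagonal_inter r I t D. a \<in> underS r c"
      using \<delta>(2)[of 0] by (auto simp: x_def)
  qed
qed

lemma closed_in_order_INT:
  assumes "K \<noteq> {}" "\<And>k. k \<in> K \<Longrightarrow> closed_in_order r (C k)"
  shows "closed_in_order r (\<Inter>k \<in> K. C k)"
  unfolding closed_in_order_underS
proof (intro ballI impI, elim conjE)
  fix \<delta> assume \<delta>: "\<delta> \<in> Field r" "underS r \<delta> \<noteq> {}"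
    and lim: "\<forall>a \<in> underS r \<delta>. \<exists>c \<in> (\<Inter>k \<in> K. C k) \<inter> underS r \<delta>. a \<in> underS r c"
  show "\<delta> \<in> (\<Inter>k \<in> K. C k)"
  proof
    fix k assume k: "k \<in> K"
    then have "\<forall>a \<in> underS r \<delta>. \<exists>c \<in> C k \<inter> underS r \<delta>. a \<in> underS r c"
      using lim by fast
    then show "\<delta> \<in> C k"
      using assms(2)[OF k] \<delta> unfolding closed_in_order_underS by blast
  qed
qed

section \<open>Countability and the first uncountable cardinal\<close>

lemma Card_order_omega1: "Card_order omega1"
  by (simp add: cardSuc_Card_order natLeq_Card_order)

lemma Well_order_omega1: "Well_order omega1"
  using Card_order_omega1 card_order_on_well_order_on by blast

lemma Field_omega1_nonempty: "Field omega1 \<noteq> {}"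
  using Field_cardSuc_not_empty natLeq_Card_order by blast

lemma countable_iff_less_omega1: "countable A \<longleftrightarrow> |A| <o omega1"
  unfolding countable_card_le_natLeq
  using cardSuc_ordLeq_ordLess[OF natLeq_Card_order card_of_Card_order, of A] by blast

text \<open>Stated with \<open>Field omega1\<close> so that \<open>card_of_ordLeq\<close> turns
  uncountability into an injection on \<open>Field omega1\<close>.\<close>

lemma uncountable_iff_omega1_leq: "uncountable A \<longleftrightarrow> |Field omega1| \<le>o |A|"
proof -
  have "uncountable A \<longleftrightarrow> omega1 \<le>o |A|"
    unfolding countable_iff_less_omega1
    using not_ordLess_iff_ordLeq[OF Well_order_omega1 card_of_Well_order] by blast
  also have "\<dots> \<longleftrightarrow> |Field omega1| \<le>o |A|"
    using ordIso_ordLeq_trans[OF card_of_Field_ordIso[OF Card_order_omega1], of "|A|"]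
      ordIso_ordLeq_trans[OF ordIso_symmetric[OF card_of_Field_ordIso[OF Card_order_omega1]], of "|A|"]
    by (rule iffI)
  finally show ?thesis .
qed

lemma countable_underS_omega1:
  assumes "a \<in> Field omega1"
  shows "countable (underS omega1 a)"
  unfolding countable_iff_less_omega1 using card_of_underS[OF Card_order_omega1 assms] .

lemma countable_bounded_omega1:
  assumes "countable S" "S \<subseteq> Field omega1"
  shows "\<exists>b \<in> Field omega1. S \<subseteq> underS omega1 b"
proof -
  have "regularCard omega1"
    by (simp add: regularCard_cardSuc natLeq_Cinfinite)
  then have "\<not> cofinal S omega1"
    using assms not_ordLess_ordIso unfolding regularCard_def countable_iff_less_omega1 by blast
  then obtain a where a: "a \<in> Field omega1" "\<And>c. c \<in> S \<Longrightarrow> a \<notin> underS omega1 c"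
    unfolding cofinal_underS by blast
  \<comment> \<open>Non-cofinality leaves open that \<open>a\<close> itself is in \<open>S\<close>;
    a point above \<open>a\<close> is a strict bound.\<close>
  obtain b where b: "b \<in> Field omega1" "a \<in> underS omega1 b"
    using a(1) infinite_Card_order_limit[OF Card_order_omega1] Cinfinite_cardSuc[OF natLeq_Cinfinite]
    unfolding underS_def cinfinite_def by blast
  have "c \<in> underS omega1 b" if "c \<in> S" for c
    using underS_total[OF Well_order_omega1 a(1), of c] a(2) b that assms(2)
      underS_trans[OF Well_order_omega1] by blast
  then show ?thesis
    using b by blast
qed

section \<open>Bad families of clubs, and the common core of (A) and (B)\<close>

text \<open>By minimality of \<open>gp\<close>, the cardinal of \<open>S\<close> has a
  counterexample family indexed by its successor. Pulling it back along an injection of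
  \<open>S\<close> into that successor keeps it bad.\<close>

lemma not_gp_property_family:
  fixes S :: "'m set"
  assumes "|S| <o gp"
  obtains D :: "'m \<Rightarrow> nat set set" where "\<And>x. x \<in> S \<Longrightarrow> club omega1 (D x)"
    "\<And>h. inj_on h (Field omega1) \<Longrightarrow> h ` Field omega1 \<subseteq> S \<Longrightarrow>
       \<not> club omega1 (\<Inter>\<beta> \<in> Field omega1. D (h \<beta>))"
proof -
  let ?F = "Field (cardSuc |S| )"
  have "\<not> gp_property |S|"
    using assms gp_least[OF card_of_Card_order, of S] not_ordLess_ordLeq by blast
  then obtain C :: "'m set \<Rightarrow> nat set set" where C: "\<forall>\<alpha> \<in> ?F. club omega1 (C \<alpha>)"
      "\<And>h. inj_on h (Field omega1) \<Longrightarrow> h ` Field omega1 \<subseteq> ?F \<Longrightarrow>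
         \<not> club omega1 (\<Inter>\<beta> \<in> Field omega1. C (h \<beta>))"
    unfolding gp_property_def by blast
  have "|S| \<le>o |?F|"
    using cardSuc_ordLeq[OF card_of_Card_order, of S]
      card_of_Field_ordIso[OF cardSuc_Card_order[OF card_of_Card_order, of S]]
      ordIso_symmetric ordLeq_ordIso_trans by blast
  then obtain e where e: "inj_on e S" "e ` S \<subseteq> ?F"
    using card_of_ordLeq by metis
  have "\<not> club omega1 (\<Inter>\<beta> \<in> Field omega1. (C \<circ> e) (h \<beta>))"
    if h: "inj_on h (Field omega1)" "h ` Field omega1 \<subseteq> S" for h
  proof -
    have "inj_on (e \<circ> h) (Field omega1)"
      using h e(1) by (meson comp_inj_on inj_on_subset)
    moreover have "(e \<circ> h) ` Field omega1 \<subseteq> ?F"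
      using h(2) e(2) by auto
    ultimately show ?thesis
      using C(2)[of "e \<circ> h"] by simp
  qed
  moreover have "club omega1 ((C \<circ> e) x)" if "x \<in> S" for x
    using C(1) e(2) that by auto
  ultimately show thesis
    using that by blast
qed

text \<open>The map \<open>t\<close> delays each coordinate until only countably many are active, so
  that the clubs can be intersected diagonally. The countable \<open>K\<close> is what lets a single
  coordinate take uncountably many values.\<close>

lemma gp_neq_if_countably_many_coordinates:
  fixes \<mu> :: "'m rel" and m :: "'i \<Rightarrow> 'm" and f :: "'m set \<Rightarrow> 'i \<Rightarrow> 'm" and t :: "'i \<Rightarrow> nat set"
  assumes \<mu>: "Card_order \<mu>"
    and m: "\<And>i. i \<in> I \<Longrightarrow> m i \<in> Field \<mu>"
    and f: "\<And>\<alpha> i. \<alpha> \<in> Field (cardSuc \<mu>) \<Longrightarrow> i \<in> I \<Longrightarrow> f \<alpha> i \<in> underS \<mu> (m i)"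
    and t: "\<And>i. i \<in> I \<Longrightarrow> t i \<in> Field omega1"
      "\<And>\<xi>. \<xi> \<in> Field omega1 \<Longrightarrow> countable {i \<in> I. t i \<in> underS omega1 \<xi>}"
    and unctbl: "\<And>A. A \<subseteq> Field (cardSuc \<mu>) \<Longrightarrow> |A| =o omega1 \<Longrightarrow>
      \<exists>K \<subseteq> I. countable K \<and> uncountable {f \<alpha> i |\<alpha> i. \<alpha> \<in> A \<and> i \<in> K}"
  shows "\<not> gp =o \<mu>"
proof
  assume gp: "gp =o \<mu>"
  let ?W = "Field omega1"
  define P where "P i D \<longleftrightarrow> (\<forall>x \<in> underS \<mu> (m i). club omega1 (D x)) \<and>
    (\<forall>h. inj_on h ?W \<longrightarrow> h ` ?W \<subseteq> underS \<mu> (m i) \<longrightarrow>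
       \<not> club omega1 (\<Inter>\<beta> \<in> ?W. D (h \<beta>)))" for i and D :: "'m \<Rightarrow> nat set set"
  have "\<exists>D. P i D" if i: "i \<in> I" for i
  proof -
    have "|underS \<mu> (m i)| <o gp"
      using card_of_underS[OF \<mu> m[OF i]] gp ordIso_symmetric ordLess_ordIso_trans by blast
    then show ?thesis
      using not_gp_property_family[of "underS \<mu> (m i)"] unfolding P_def by metis
  qed
  then obtain D where "\<forall>i \<in> I. P i (D i)"
    by metis
  then have D: "\<And>i x. i \<in> I \<Longrightarrow> x \<in> underS \<mu> (m i) \<Longrightarrow> club omega1 (D i x)"
      "\<And>i h. i \<in> I \<Longrightarrow> inj_on h ?W \<Longrightarrow> h ` ?W \<subseteq> underS \<mu> (m i) \<Longrightarrow>
         \<not> club omega1 (\<Inter>\<beta> \<in> ?W. D i (h \<beta>))"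
    unfolding P_def by auto
  define C where "C \<alpha> = diagonal_inter omega1 I t (\<lambda>i. D i (f \<alpha> i))" for \<alpha>
  have "club omega1 (C \<alpha>)" if "\<alpha> \<in> Field (cardSuc \<mu>)" for \<alpha>
    unfolding C_def using that D(1) f t(2)
    by (intro club_diagonal_inter Well_order_omega1 countable_bounded_omega1) auto
  \<comment> \<open>The property is moved from the carrier of \<open>gp\<close> to that of \<mu>,
    whose successor indexes \<open>f\<close>.\<close>
  moreover have "gp_property \<mu>"
    using gp_property_mono[OF Card_order_gp \<mu> _ gp_property_gp] gp ordIso_imp_ordLeq by blast
  ultimately obtain h where h: "inj_on h ?W" "h ` ?W \<subseteq> Field (cardSuc \<mu>)"
      "club omega1 (\<Inter>\<beta> \<in> ?W. C (h \<beta>))"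
    unfolding gp_property_def by blast
  have "|h ` ?W| =o omega1"
    using h(1) card_of_Field_ordIso[OF Card_order_omega1] card_of_ordIso inj_on_imp_bij_betw
      ordIso_symmetric ordIso_transitive by metis
  then obtain K where K: "K \<subseteq> I" "countable K"
      "uncountable {f \<alpha> i |\<alpha> i. \<alpha> \<in> h ` ?W \<and> i \<in> K}"
    using unctbl[OF h(2)] by blast
  have "{f \<alpha> i |\<alpha> i. \<alpha> \<in> h ` ?W \<and> i \<in> K} = (\<Union>i \<in> K. (\<lambda>\<alpha>. f \<alpha> i) ` h ` ?W)"
    by blast
  then have "uncountable (\<Union>i \<in> K. (\<lambda>\<alpha>. f \<alpha> i) ` h ` ?W)"
    using K(3) by simp
  \<comment> \<open>A countable union of countable sets is countable.\<close>
  then have "\<exists>i \<in> K. uncountable ((\<lambda>\<alpha>. f \<alpha> i) ` h ` ?W)"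
    by (rule contrapos_np) (intro countable_UN K(2), simp)
  then obtain i where i: "i \<in> I" "uncountable ((\<lambda>\<alpha>. f \<alpha> i) ` h ` ?W)"
    using K(1) by blast
  then obtain k where k: "inj_on k ?W" "k ` ?W \<subseteq> (\<lambda>\<alpha>. f \<alpha> i) ` h ` ?W"
    unfolding uncountable_iff_omega1_leq card_of_ordLeq[symmetric] by blast
  have kS: "k ` ?W \<subseteq> underS \<mu> (m i)"
  proof (rule subset_trans[OF k(2)], rule image_subsetI)
    fix \<alpha> assume "\<alpha> \<in> h ` ?W"
    then show "f \<alpha> i \<in> underS \<mu> (m i)"
      using h(2) f[OF _ i(1)] by blast
  qed
  have clubs: "club omega1 (D i (k \<beta>))" if "\<beta> \<in> ?W" for \<beta>
    using D(1)[OF i(1) subsetD[OF kS imageI[OF that]]] .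
  have "cofinal (\<Inter>\<beta> \<in> ?W. D i (k \<beta>)) omega1"
    unfolding cofinal_underS
  proof
    fix a assume a: "a \<in> ?W"
    \<comment> \<open>Beyond \<open>t i\<close>, each \<open>C (h \<beta>)\<close> is contained in
      \<open>D i (f (h \<beta>) i)\<close>, and every \<open>k \<beta>\<close> is one of these
      values. Hence a tail of the club intersection lies in all
      \<open>D i (k \<beta>)\<close>.\<close>
    obtain b where b: "b \<in> ?W"
        "\<And>d. b \<in> underS omega1 d \<Longrightarrow> a \<in> underS omega1 d \<and> t i \<in> underS omega1 d"
      using underS_max[OF Well_order_omega1 a t(1)[OF i(1)]] by blast
    obtain c where c: "c \<in> (\<Inter>\<beta> \<in> ?W. C (h \<beta>))" "b \<in> underS omega1 c"
      using h(3) b(1) unfolding club_def cofinal_underS by (elim conjE) (drule (1) bspec, blast)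
    have "c \<in> D i (f (h \<beta>) i)" if "\<beta> \<in> ?W" for \<beta>
      using c b(2)[OF c(2)] that i(1) unfolding C_def diagonal_inter_def by blast
    then have "c \<in> D i (k \<beta>)" if "\<beta> \<in> ?W" for \<beta>
      using k(2) that by auto
    then show "\<exists>c \<in> (\<Inter>\<beta> \<in> ?W. D i (k \<beta>)). a \<in> underS omega1 c"
      using b(2)[OF c(2)] by blast
  qed
  moreover have "closed_in_order omega1 (\<Inter>\<beta> \<in> ?W. D i (k \<beta>))"
    using clubs unfolding club_def by (intro closed_in_order_INT Field_omega1_nonempty) blast
  moreover have "(\<Inter>\<beta> \<in> ?W. D i (k \<beta>)) \<subseteq> ?W"
    using clubs Field_omega1_nonempty unfolding club_def by blast
  ultimately show False
    using D(2)[OF i(1) k(1) kS] unfolding club_def by blast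
qed

section \<open>The two cofinality cases\<close>

lemma uncountable_if_card_omega1:
  assumes "|A| =o omega1"
  shows "uncountable A"
  using assms not_ordLess_ordIso unfolding countable_iff_less_omega1 by blast

theorem theorem3p3:
  fixes \<mu> :: "'m rel"
  assumes "singular_cardinal \<mu>"
  shows
    "(\<forall>(m :: nat \<Rightarrow> 'm) (J :: nat set set) (f :: 'm set \<Rightarrow> nat \<Rightarrow> 'm).
        cf \<mu> =o natLeq \<and> natLeq <o \<mu> \<and> \<mu> <o continuum \<and>
        regular_sequence natLeq \<mu> m \<and>
        ideal_on (Field natLeq) J \<and> (\<forall>B. bounded_subset natLeq B \<longrightarrow> B \<in> J) \<and>
        tcf_scale (Field natLeq) J \<mu> m (cardSuc \<mu>) f \<and>
        (\<forall>A \<subseteq> Field (cardSuc \<mu>). |A| =o omega1 \<longrightarrow>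
           |{f \<alpha> n |\<alpha> n. \<alpha> \<in> A \<and> n \<in> Field natLeq}| =o omega1)
        \<longrightarrow> \<not> gp =o \<mu>)
     \<and>
     (\<forall>(m :: nat set \<Rightarrow> 'm) (J :: nat set set set) (g :: 'm set \<Rightarrow> nat set \<Rightarrow> 'm).
        cf \<mu> =o omega1 \<and> omega1 <o \<mu> \<and> \<mu> \<le>o continuum \<and>
        regular_sequence omega1 \<mu> m \<and>
        ideal_on (Field omega1) J \<and> (\<forall>B. bounded_subset omega1 B \<longrightarrow> B \<in> J) \<and>
        tcf_scale (Field omega1) J \<mu> m (cardSuc \<mu>) g \<and>
        (\<forall>A \<subseteq> Field (cardSuc \<mu>). |A| =o omega1 \<longrightarrow>
           (\<exists>\<delta> \<in> Field omega1. |{g \<alpha> \<gamma> |\<alpha> \<gamma>. \<alpha> \<in> A \<and> \<gamma> \<in> underS omega1 \<delta>}| =o omega1))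
        \<longrightarrow> \<not> gp =o \<mu>)"
proof (intro conjI allI impI)
  have \<mu>: "Card_order \<mu>"
    using assms unfolding singular_cardinal_def by blast
  {
    fix m :: "nat \<Rightarrow> 'm" and J :: "nat set set" and f :: "'m set \<Rightarrow> nat \<Rightarrow> 'm"
    assume H: "cf \<mu> =o natLeq \<and> natLeq <o \<mu> \<and> \<mu> <o continuum \<and>
        regular_sequence natLeq \<mu> m \<and>
        ideal_on (Field natLeq) J \<and> (\<forall>B. bounded_subset natLeq B \<longrightarrow> B \<in> J) \<and>
        tcf_scale (Field natLeq) J \<mu> m (cardSuc \<mu>) f \<and>
        (\<forall>A \<subseteq> Field (cardSuc \<mu>). |A| =o omega1 \<longrightarrow>
           |{f \<alpha> n |\<alpha> n. \<alpha> \<in> A \<and> n \<in> Field natLeq}| =o omega1)"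
    obtain z where z: "z \<in> Field omega1"
      using Field_omega1_nonempty by blast
    show "\<not> gp =o \<mu>"
    \<comment> \<open>With countably many coordinates, all may become active at once past an
      arbitrary \<open>z\<close>, and \<open>K\<close> is the whole index set.\<close>
    proof (rule gp_neq_if_countably_many_coordinates[OF \<mu>, of "Field natLeq" m f "\<lambda>_. z"])
      fix A assume "A \<subseteq> Field (cardSuc \<mu>)" "|A| =o omega1"
      then have "uncountable {f \<alpha> n |\<alpha> n. \<alpha> \<in> A \<and> n \<in> Field natLeq}"
        using H uncountable_if_card_omega1 by blast
      then show "\<exists>K \<subseteq> Field natLeq. countable K \<and> uncountable {f \<alpha> n |\<alpha> n. \<alpha> \<in> A \<and> n \<in> K}"
        by blast
    qed (use H z in \<open>auto simp: regular_sequence_def tcf_scale_def\<close>)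
  next
    fix m :: "nat set \<Rightarrow> 'm" and J :: "nat set set set" and g :: "'m set \<Rightarrow> nat set \<Rightarrow> 'm"
    assume H: "cf \<mu> =o omega1 \<and> omega1 <o \<mu> \<and> \<mu> \<le>o continuum \<and>
        regular_sequence omega1 \<mu> m \<and>
        ideal_on (Field omega1) J \<and> (\<forall>B. bounded_subset omega1 B \<longrightarrow> B \<in> J) \<and>
        tcf_scale (Field omega1) J \<mu> m (cardSuc \<mu>) g \<and>
        (\<forall>A \<subseteq> Field (cardSuc \<mu>). |A| =o omega1 \<longrightarrow>
           (\<exists>\<delta> \<in> Field omega1. |{g \<alpha> \<gamma> |\<alpha> \<gamma>. \<alpha> \<in> A \<and> \<gamma> \<in> underS omega1 \<delta>}| =o omega1))"
    show "\<not> gp =o \<mu>"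
    \<comment> \<open>Here coordinate \<gamma> waits until \<gamma> is passed, and \<open>K\<close>
      is the countable segment below the \<delta> given by (c).\<close>
    proof (rule gp_neq_if_countably_many_coordinates[OF \<mu>, of "Field omega1" m g "\<lambda>\<gamma>. \<gamma>"])
      fix A assume "A \<subseteq> Field (cardSuc \<mu>)" "|A| =o omega1"
      then obtain \<delta> where "\<delta> \<in> Field omega1"
          "|{g \<alpha> \<gamma> |\<alpha> \<gamma>. \<alpha> \<in> A \<and> \<gamma> \<in> underS omega1 \<delta>}| =o omega1"
        using H by blast
      then show "\<exists>K \<subseteq> Field omega1. countable K \<and> uncountable {g \<alpha> \<gamma> |\<alpha> \<gamma>. \<alpha> \<in> A \<and> \<gamma> \<in> K}"
        using uncountable_if_card_omega1 countable_underS_omega1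
          Order_Relation.underS_Field[of omega1 \<delta>]
        by (intro exI[of _ "underS omega1 \<delta>"] conjI)
    next
      fix \<xi> assume "\<xi> \<in> Field omega1"
      then show "countable {\<gamma> \<in> Field omega1. \<gamma> \<in> underS omega1 \<xi>}"
        by (rule countable_subset[OF _ countable_underS_omega1, rotated]) blast
    qed (use H in \<open>auto simp: regular_sequence_def tcf_scale_def\<close>)
  }
qed

end
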